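(* Let $X$ be a nonempty $T_0$ space, let $\mathscr{S}$ be a subbase of $X$ with $\emptyset\notin\mathscr{S}$, let $Y_S$ be a nonempty topological space for each $S\in\mathscr{S}$, and let $Y$ be the amalgam of $\langle Y_S\rangle_{S\in\mathscr{S}}$. Suppose $i\in\{1,2,3,3\frac{1}{2}\}$, $X$ has a $T_i$ connectification, and $Y_S$ is $T_i$ for all $S\in\mathscr{S}$. Further suppose that at least one of the following holds: $X$ has a proper $T_i$ connectification; or $X\notin\mathscr{S}$; or $X\in\mathscr{S}$ and $Y_X$ (the factor $Y_S$ for $S=X$) is connected. Then $Y$ has a $T_i$ connectification.
   Context: Amalgam: let $X$ be a nonempty $T_0$ space, $\mathscr{S}$ a subbase of $X$ (a family of open sets whose finite intersections, the empty intersection being $X$, form a base) with $\emptyset\notin\mathscr{S}$, and $Y_S$ a nonempty topological space for each $S\in\mathscr{S}$. The amalgam of $\langle Y_S\rangle_{S\in\mathscr{S}}$ is the set $Y=\bigcup_{p\in X}\prod_{p\in S\in\mathscr{S}}Y_S$, where the product over $p\in S\in\mathscr{S}$ is the set of functions $y$ with domain $\{S\in\mathscr{S}:p\in S\}$ such that $y(S)\in Y_S$ for all $S$ in the domain. It is topologized by taking as a subbase all sets $\{y\in Y: S\in\mathrm{dom}\,y\text{ and }y(S)\in U\}$ with $S\in\mathscr{S}$ and $U$ open in $Y_S$. $X$ is called the base space of $Y$ and the $Y_S$ its factors. A connected space $W$ is a connectification of a space $V$ if $V$ can be densely embedded in $W$; it is proper if the dense embedding can be chosen not to be surjective. A $T_i$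 connectification is a connectification that is itself a $T_i$ space. $T_3$ means regular and $T_1$; $T_{3\frac12}$ means completely regular and $T_1$. *)

theory Defs
  imports "HOL-Analysis.Analysis"
begin

definition base_of :: "'a topology \<Rightarrow> 'a set set \<Rightarrow> bool" where
  "base_of X \<B> \<longleftrightarrow> openin X = arbitrary union_of (\<lambda>U. U \<in> \<B>)"

(* \<open>relative_to topspace X\<close> turns the empty intersection UNIV into the whole space. *)
definition subbase_of :: "'a topology \<Rightarrow> 'a set set \<Rightarrow> bool" where
  "subbase_of X \<S> \<longleftrightarrow>
     (\<forall>S\<in>\<S>. openin X S) \<and>
     base_of X {U. (finite intersection_of (\<lambda>S. S \<in> \<S>) relative_to topspace X) U}"

(* A function with domain {S \<in> \<S>. p \<in> S} is encoded as a partial function.  All factors live on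
   one type 'b, but each has its own carrier topspace (Y S); any indexed family of spaces is of
   this form up to homeomorphism (take 'b to be a disjoint sum). *)
definition amalgam_points ::
    "'a topology \<Rightarrow> 'a set set \<Rightarrow> ('a set \<Rightarrow> 'b topology) \<Rightarrow> ('a set \<rightharpoonup> 'b) set" where
  "amalgam_points X \<S> Y =
     (\<Union>p\<in>topspace X. {y. dom y = {S \<in> \<S>. p \<in> S} \<and> (\<forall>S\<in>dom y. the (y S) \<in> topspace (Y S))})"

(* A point of the base space may lie in no member of \<S>, giving the empty function, which lies in
   no subbasic set; hence again the relativization to the whole point set. *)
definition amalgam ::
    "'a topology \<Rightarrow> 'a set set \<Rightarrow> ('a set \<Rightarrow> 'b topology) \<Rightarrow> ('a set \<rightharpoonup> 'b) topology" where
  "amalgam X \<S> Y = topology (arbitrary union_of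
     (finite intersection_of
        (\<lambda>V. \<exists>S\<in>\<S>. \<exists>U. openin (Y S) U \<and>
              V = {y \<in> amalgam_points X \<S> Y. S \<in> dom y \<and> the (y S) \<in> U})
      relative_to amalgam_points X \<S> Y))"

lemma topspace_amalgam: "topspace (amalgam X \<S> Y) = amalgam_points X \<S> Y"
  unfolding amalgam_def by (rule topspace_subbase)

datatype separation_index = T_1 | T_2 | T_3 | T_3half

fun T_space :: "separation_index \<Rightarrow> 'a topology \<Rightarrow> bool" where
  "T_space T_1 X \<longleftrightarrow> t1_space X"
| "T_space T_2 X \<longleftrightarrow> Hausdorff_space X"
| "T_space T_3 X \<longleftrightarrow> regular_space X \<and> t1_space X"
| "T_space T_3half X \<longleftrightarrow> completely_regular_space X \<and> t1_space X"

definition dense_embedding :: "'a topology \<Rightarrow> 'b topology \<Rightarrow> ('a \<Rightarrow> 'b) \<Rightarrow> bool" where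
  "dense_embedding V W f \<longleftrightarrow>
     embedding_map V W f \<and> W closure_of (f ` topspace V) = topspace W"

definition connectification :: "'a topology \<Rightarrow> 'b topology \<Rightarrow> bool" where
  "connectification V W \<longleftrightarrow> connected_space W \<and> (\<exists>f. dense_embedding V W f)"

definition proper_connectification :: "'a topology \<Rightarrow> 'b topology \<Rightarrow> bool" where
  "proper_connectification V W \<longleftrightarrow>
     connected_space W \<and> (\<exists>f. dense_embedding V W f \<and> f ` topspace V \<noteq> topspace W)"

end

theory Submission
  imports Defs
begin

text \<open>Let \<open>f\<close> embed \<open>X\<close> densely in a connected space \<open>W\<close>, and extend each member \<open>S\<close> of the
  subbase to an open set \<open>e S\<close> of \<open>W\<close> with trace \<open>S\<close>. The connectification of the amalgam is the
  amalgam over \<open>W\<close>, with all open sets of \<open>W\<close> as subbase, in which \<open>e S\<close> carries the factor \<open>Y S\<close>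
  and every other open set a one-point factor. An amalgam over a connected base is connected as soon
  as the factor over the whole base space (if there is one) is: a simultaneous choice \<open>z\<close> of points
  in all factors gives a continuous section of the projection to the base, two sections that differ
  only at \<open>T\<close> meet over the complement of \<open>T\<close>, and the sections obtained from a fixed one by finitely
  many changes have dense union.\<close>

section \<open>Subbases\<close>

lemma subbase_of_topology:
  assumes "subbase_of X \<S>"
  shows "X = topology (arbitrary union_of
           (finite intersection_of (\<lambda>S. S \<in> \<S>) relative_to topspace X))"
proof -
  have "openin X = arbitrary union_of (finite intersection_of (\<lambda>S. S \<in> \<S>) relative_to topspace X)"
    using assms by (simp add: subbase_of_def base_of_def)
  then show ?thesis
    by (metis openin_inverse)
qed

lemma subbase_of_nhd:
  assumes "subbase_of X \<S>" "openin X U" "x \<in> U"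
  obtains F where "finite F" "F \<subseteq> \<S>" "x \<in> \<Inter>F" "topspace X \<inter> \<Inter>F \<subseteq> U"
proof -
  have "(arbitrary union_of (\<lambda>U. (finite intersection_of (\<lambda>S. S \<in> \<S>) relative_to topspace X) U)) U"
    using assms unfolding subbase_of_def base_of_def by auto
  then obtain V where "(finite intersection_of (\<lambda>S. S \<in> \<S>) relative_to topspace X) V" "x \<in> V" "V \<subseteq> U"
    using \<open>x \<in> U\<close> unfolding union_of_def by auto
  then show thesis
    using that unfolding relative_to_def intersection_of_def by auto
qed

lemma continuous_map_into_subbase_of:
  assumes Y: "subbase_of Y \<S>"
    and "\<And>x. x \<in> topspace X \<Longrightarrow> f x \<in> topspace Y"
    and "\<And>S. S \<in> \<S> \<Longrightarrow> openin X {x \<in> topspace X. f x \<in> S}"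
  shows "continuous_map X Y f"
  using continuous_map_into_topology_subbase_eq[OF subbase_of_topology[OF Y]] assms(2,3) by auto

lemma subbase_of_all_open: "subbase_of X {U. openin X U}"
proof -
  have "(finite intersection_of (openin X) relative_to topspace X) U \<longleftrightarrow> openin X U" for U
  proof
    assume "(finite intersection_of (openin X) relative_to topspace X) U"
    then obtain F where F: "finite F" "F \<subseteq> Collect (openin X)" "U = topspace X \<inter> \<Inter>F"
      unfolding relative_to_def intersection_of_def by auto
    have "openin X (\<Inter>(insert (topspace X) F))"
      using F by (intro openin_Inter) auto
    then show "openin X U"
      using F by simp
  next
    assume "openin X U"
    then show "(finite intersection_of (openin X) relative_to topspace X) U"
      by (meson finite_intersection_of_inc openin_subset relative_to_subset_inc)
  qed
  then show ?thesis
    unfolding subbase_of_def base_of_def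
    by (auto simp: union_of_def arbitrary_def fun_eq_iff)
qed

text \<open>A finite intersection of subbasic sets around one point also contains the other, so both
  lie in the same open sets. This lets the domain of a point of an amalgam determine the base point
  beneath it.\<close>

lemma t0_space_subbase_of:
  assumes "subbase_of X \<S>" "t0_space X" "x \<in> topspace X" "y \<in> topspace X"
    and "{S \<in> \<S>. x \<in> S} = {S \<in> \<S>. y \<in> S}"
  shows "x = y"
proof (rule ccontr)
  have same_opens: "b \<in> U" if ab: "openin X U" "a \<in> U" "b \<in> topspace X"
    "{S \<in> \<S>. a \<in> S} = {S \<in> \<S>. b \<in> S}" for a b U
  proof -
    obtain F where "finite F" "F \<subseteq> \<S>" "a \<in> \<Inter>F" "topspace X \<inter> \<Inter>F \<subseteq> U"
      by (rule subbase_of_nhd[OF assms(1) ab(1,2)])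
    with ab show ?thesis by blast
  qed
  assume "x \<noteq> y"
  then obtain U where "openin X U" "x \<notin> U \<longleftrightarrow> y \<in> U"
    using assms(2-4) unfolding t0_space_def by blast
  then show False
    using same_opens[of U x y] same_opens[of U y x] assms(3-5) by auto
qed

text \<open>Finitely many members of the subbase cut out a neighbourhood of \<open>x\<close>;
  intersecting the open and the closed sets supplied for each of them gives one such pair inside
  it.\<close>

lemma regular_space_subbase_of:
  assumes X: "subbase_of X \<S>"
    and step: "\<And>S x. \<lbrakk>S \<in> \<S>; x \<in> S\<rbrakk> \<Longrightarrow> \<exists>U C. openin X U \<and> closedin X C \<and> x \<in> U \<and> U \<subseteq> C \<and> C \<subseteq> S"
  shows "regular_space X"
  unfolding neighbourhood_base_of_closedin [symmetric] neighbourhood_base_of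
proof (intro allI impI)
  fix W x
  assume "openin X W \<and> x \<in> W"
  then have W: "openin X W" "x \<in> W" by auto
  obtain F where F: "finite F" "F \<subseteq> \<S>" "x \<in> \<Inter>F" "topspace X \<inter> \<Inter>F \<subseteq> W"
    by (rule subbase_of_nhd[OF X W])
  have "\<forall>S\<in>F. \<exists>U C. openin X U \<and> closedin X C \<and> x \<in> U \<and> U \<subseteq> C \<and> C \<subseteq> S"
    using F(2,3) by (intro ballI step) auto
  from bchoice[OF this] obtain U
    where "\<forall>S\<in>F. \<exists>C. openin X (U S) \<and> closedin X C \<and> x \<in> U S \<and> U S \<subseteq> C \<and> C \<subseteq> S" ..
  from bchoice[OF this] obtain C
    where UC: "\<forall>S\<in>F. openin X (U S) \<and> closedin X (C S) \<and> x \<in> U S \<and> U S \<subseteq> C S \<and> C S \<subseteq> S" ..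
  have x: "x \<in> topspace X"
    using W openin_subset by blast
  \<comment> \<open>Inserting the whole space covers the case of an empty \<open>F\<close>.\<close>
  have "openin X (\<Inter>(insert (topspace X) (U ` F)))"
    using UC F(1) by (intro openin_Inter) auto
  moreover have "closedin X (\<Inter>(insert (topspace X) (C ` F)))"
    using UC by (intro closedin_Inter) auto
  moreover have "x \<in> \<Inter>(insert (topspace X) (U ` F))"
    using UC x by simp
  moreover have "\<Inter>(insert (topspace X) (U ` F)) \<subseteq> \<Inter>(insert (topspace X) (C ` F))"
  proof -
    have "\<Inter>(U ` F) \<subseteq> \<Inter>(C ` F)"
      using UC by (intro INF_mono) metis
    then show ?thesis by auto
  qed
  moreover have "\<Inter>(insert (topspace X) (C ` F)) \<subseteq> topspace X \<inter> \<Inter>F"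
  proof -
    have "\<Inter>(C ` F) \<subseteq> \<Inter>F"
      using UC by (intro Inter_greatest) (metis INF_lower2)
    then show ?thesis by auto
  qed
  moreover note F(4)
  ultimately show "\<exists>U V. openin X U \<and> closedin X V \<and> x \<in> U \<and> U \<subseteq> V \<and> V \<subseteq> W"
    by (metis order_trans)
qed

text \<open>The bound \<open>\<ge> 1\<close> survives taking maxima, so one function per subbasic
  set combines to one for a finite intersection. Truncation at 1 then gives the exact value outside
  the neighbourhood.\<close>

lemma completely_regular_space_subbase_of:
  assumes X: "subbase_of X \<S>"
    and step: "\<And>S x. \<lbrakk>S \<in> \<S>; x \<in> S\<rbrakk> \<Longrightarrow>
      \<exists>f. continuous_map X euclideanreal f \<and> f x = 0 \<and> (\<forall>y\<in>topspace X - S. f y \<ge> 1)"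
  shows "completely_regular_space X"
  unfolding completely_regular_space_alt'
proof (intro allI impI)
  fix W x
  assume W: "openin X W" "x \<in> W"
  obtain F where F: "finite F" "F \<subseteq> \<S>" "x \<in> \<Inter>F" "topspace X \<inter> \<Inter>F \<subseteq> W"
    by (rule subbase_of_nhd[OF X W])
  have "\<exists>f. continuous_map X euclideanreal f \<and> f x = 0 \<and> (\<forall>y\<in>topspace X - \<Inter>F. f y \<ge> 1)"
    using F(1-3)
  proof (induction F)
    case empty
    then show ?case by (intro exI[of _ "\<lambda>_. 0"]) auto
  next
    case (insert S F)
    then obtain f g where "continuous_map X euclideanreal f" "f x = 0" "\<forall>y\<in>topspace X - \<Inter>F. f y \<ge> 1"
       and "continuous_map X euclideanreal g" "g x = 0" "\<forall>y\<in>topspace X - S. g y \<ge> 1"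
      using step[of S x] by auto
    then show ?case
      by (intro exI[of _ "\<lambda>y. max (f y) (g y)"]) (auto intro!: continuous_map_real_max simp: le_max_iff_disj)
  qed
  then obtain f where f: "continuous_map X euclideanreal f" "f x = 0" "\<forall>y\<in>topspace X - \<Inter>F. f y \<ge> 1"
    by blast
  have "continuous_map X euclideanreal (\<lambda>y. min (f y) 1)"
    using f by (intro continuous_map_real_min) auto
  moreover have "(\<lambda>y. min (f y) 1) ` (topspace X - W) \<subseteq> {1}"
  proof (intro image_subsetI)
    fix y assume "y \<in> topspace X - W"
    then have "y \<in> topspace X - \<Inter>F"
      using F(4) by blast
    then show "min (f y) 1 \<in> {1}"
      using f(3) by simp
  qed
  moreover have "min (f x) 1 = 0"
    by (simp add: f(2))
  ultimately show "\<exists>f. continuous_map X euclideanreal f \<and> f x = 0 \<and> f ` (topspace X - W) \<subseteq> {1}"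
    by blast
qed

section \<open>Amalgams\<close>

definition amalgam_cylinder ::
    "'a topology \<Rightarrow> 'a set set \<Rightarrow> ('a set \<Rightarrow> 'b topology) \<Rightarrow> 'a set \<Rightarrow> 'b set \<Rightarrow> ('a set \<rightharpoonup> 'b) set" where
  "amalgam_cylinder X \<S> Y S U = {y \<in> amalgam_points X \<S> Y. S \<in> dom y \<and> the (y S) \<in> U}"

text \<open>\<open>z\<close> is total, so a single choice yields a point over every \<open>p\<close>
  at once, and hence a section of the projection to the base.\<close>

definition amalgam_section :: "'a set set \<Rightarrow> ('a set \<Rightarrow> 'b) \<Rightarrow> 'a \<Rightarrow> ('a set \<rightharpoonup> 'b)" where
  "amalgam_section \<S> z p = (\<lambda>S. if S \<in> \<S> \<and> p \<in> S then Some (z S) else None)"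

lemma dom_amalgam_section: "dom (amalgam_section \<S> z p) = {S \<in> \<S>. p \<in> S}"
  by (auto simp: amalgam_section_def split: if_splits)

text \<open>The point below is unique if \<open>X\<close> is \<open>T\<^sub>0\<close>; without this the projection may be junk.\<close>

definition amalgam_proj :: "'a topology \<Rightarrow> 'a set set \<Rightarrow> ('a set \<rightharpoonup> 'b) \<Rightarrow> 'a" where
  "amalgam_proj X \<S> y = (THE p. p \<in> topspace X \<and> dom y = {S \<in> \<S>. p \<in> S})"

lemma openin_amalgam_cylinder:
  assumes "S \<in> \<S>" "openin (Y S) U"
  shows "openin (amalgam X \<S> Y) (amalgam_cylinder X \<S> Y S U)"
  unfolding amalgam_def openin_subbase
proof (rule arbitrary_union_of_inc, rule relative_to_subset_inc)
  show "amalgam_cylinder X \<S> Y S U \<subseteq> amalgam_points X \<S> Y"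
    by (auto simp: amalgam_cylinder_def)
  show "(finite intersection_of
     (\<lambda>V. \<exists>S\<in>\<S>. \<exists>U. openin (Y S) U \<and> V = {y \<in> amalgam_points X \<S> Y. S \<in> dom y \<and> the (y S) \<in> U}))
     (amalgam_cylinder X \<S> Y S U)"
    using assms by (intro finite_intersection_of_inc) (auto simp: amalgam_cylinder_def)
qed

lemma subbase_of_amalgam:
  "subbase_of (amalgam X \<S> Y) {amalgam_cylinder X \<S> Y S U |S U. S \<in> \<S> \<and> openin (Y S) U}"
proof -
  have "(\<lambda>V. \<exists>S\<in>\<S>. \<exists>U. openin (Y S) U \<and> V = {y \<in> amalgam_points X \<S> Y. S \<in> dom y \<and> the (y S) \<in> U})
      = (\<lambda>V. V \<in> {amalgam_cylinder X \<S> Y S U |S U. S \<in> \<S> \<and> openin (Y S) U})"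
    by (auto simp: amalgam_cylinder_def fun_eq_iff)
  then show ?thesis
    unfolding subbase_of_def base_of_def topspace_amalgam
    using openin_amalgam_cylinder[of _ \<S> Y _ X]
    by (auto simp: amalgam_def openin_subbase fun_eq_iff)
qed

text \<open>A basic neighbourhood tests only finitely many coordinates. Two density arguments rest
  on this: for the finite changes of a section and for the image of an amalgam over a dense
  subspace.\<close>

lemma amalgam_nhd_agree:
  assumes "openin (amalgam X \<S> Y) V" "y \<in> V"
  obtains D where "finite D" "D \<subseteq> dom y"
    "\<And>y'. \<lbrakk>y' \<in> amalgam_points X \<S> Y; \<And>S. S \<in> D \<Longrightarrow> y' S = y S\<rbrakk> \<Longrightarrow> y' \<in> V"
proof -
  obtain F where F: "finite F" "F \<subseteq> {amalgam_cylinder X \<S> Y S U |S U. S \<in> \<S> \<and> openin (Y S) U}"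
    "y \<in> \<Inter>F" "amalgam_points X \<S> Y \<inter> \<Inter>F \<subseteq> V"
    by (rule subbase_of_nhd[OF subbase_of_amalgam assms, unfolded topspace_amalgam])
  then have "\<forall>B\<in>F. \<exists>S U. B = amalgam_cylinder X \<S> Y S U"
    by blast
  then obtain s u where su: "\<And>B. B \<in> F \<Longrightarrow> B = amalgam_cylinder X \<S> Y (s B) (u B)"
    by metis
  have y: "s B \<in> dom y" "the (y (s B)) \<in> u B" if "B \<in> F" for B
  proof -
    have "y \<in> amalgam_cylinder X \<S> Y (s B) (u B)"
      using su[OF that] F(3) that by blast
    then show "s B \<in> dom y" "the (y (s B)) \<in> u B"
      by (auto simp: amalgam_cylinder_def)
  qed
  show thesis
  proof (rule that)
    show "finite (s ` F)" "s ` F \<subseteq> dom y"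
      using F(1) y(1) by auto
    fix y'
    assume y': "y' \<in> amalgam_points X \<S> Y" "\<And>S. S \<in> s ` F \<Longrightarrow> y' S = y S"
    have "y' \<in> B" if "B \<in> F" for B
    proof -
      have "y' \<in> amalgam_cylinder X \<S> Y (s B) (u B)"
        using y' y[OF that] that by (auto simp: amalgam_cylinder_def domIff)
      then show ?thesis using su[OF that] by simp
    qed
    with y'(1) F(4) show "y' \<in> V" by blast
  qed
qed

text \<open>Instantiated both by the given base space and by its connectification, so the facts
  below serve for either amalgam. Nonempty factors allow a partial point to be completed to a
  selection.\<close>

locale amalgam_system =
  fixes X :: "'a topology" and \<S> :: "'a set set" and Y :: "'a set \<Rightarrow> 'b topology"
  assumes subbase: "subbase_of X \<S>" and t0: "t0_space X"
    and factor_nonempty: "S \<in> \<S> \<Longrightarrow> topspace (Y S) \<noteq> {}"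
begin

abbreviation "Z \<equiv> amalgam X \<S> Y"
abbreviation "cyl \<equiv> amalgam_cylinder X \<S> Y"
abbreviation "\<sigma> \<equiv> amalgam_section \<S>"
abbreviation "proj \<equiv> amalgam_proj X \<S>"
abbreviation "selection z \<equiv> \<forall>S\<in>\<S>. z S \<in> topspace (Y S)"

section \<open>Points as values of sections, and the projection to the base space\<close>

lemma openin_base: "S \<in> \<S> \<Longrightarrow> openin X S"
  using subbase by (simp add: subbase_of_def)

lemma section_in_points:
  assumes "p \<in> topspace X" "selection z"
  shows "\<sigma> z p \<in> amalgam_points X \<S> Y"
  using assms unfolding amalgam_points_def
  by (auto simp: dom_amalgam_section) (auto simp: amalgam_section_def)

lemma points_cases:
  assumes "y \<in> amalgam_points X \<S> Y"
  obtains z p where "p \<in> topspace X" "selection z" "y = \<sigma> z p"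
proof -
  obtain p where p: "p \<in> topspace X" "dom y = {S \<in> \<S>. p \<in> S}"
    "\<And>S. S \<in> dom y \<Longrightarrow> the (y S) \<in> topspace (Y S)"
    using assms that unfolding amalgam_points_def by (elim UN_E) simp
  \<comment> \<open>Members of \<open>\<S>\<close> outside the domain receive arbitrary points of
    their factors; the section over \<open>p\<close> does not show them.\<close>
  define z where "z S = (if S \<in> dom y then the (y S) else (SOME u. u \<in> topspace (Y S)))" for S
  have "selection z"
    using p(3) factor_nonempty by (auto simp: z_def some_in_eq)
  moreover have "y = \<sigma> z p"
  proof
    fix S show "y S = \<sigma> z p S"
    proof (cases "S \<in> dom y")
      case True
      moreover from this p(2) have "S \<in> \<S>" "p \<in> S" by auto
      ultimately show ?thesis by (auto simp: amalgam_section_def z_def)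
    next
      case False
      moreover from this p(2) have "\<not> (S \<in> \<S> \<and> p \<in> S)" by auto
      ultimately show ?thesis by (auto simp: amalgam_section_def domIff)
    qed
  qed
  ultimately show thesis using that p(1) by blast
qed

lemma proj_section:
  assumes "p \<in> topspace X"
  shows "proj (\<sigma> z p) = p"
  unfolding amalgam_proj_def dom_amalgam_section
  using t0_space_subbase_of[OF subbase t0] assms by (intro the_equality) blast+

lemma proj_in: "y \<in> amalgam_points X \<S> Y \<Longrightarrow> proj y \<in> topspace X"
  by (erule points_cases) (simp add: proj_section)

lemma dom_proj: "y \<in> amalgam_points X \<S> Y \<Longrightarrow> dom y = {S \<in> \<S>. proj y \<in> S}"
  by (erule points_cases) (simp add: proj_section dom_amalgam_section)

lemma value_in:
  assumes "y \<in> amalgam_points X \<S> Y" "S \<in> \<S>" "proj y \<in> S"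
  shows "the (y S) \<in> topspace (Y S)"
proof -
  obtain z p where "p \<in> topspace X" "selection z" "y = \<sigma> z p"
    using assms(1) by (rule points_cases)
  with assms(2,3) show ?thesis
    by (simp add: proj_section) (simp add: amalgam_section_def)
qed

lemma in_cyl_iff: "S \<in> \<S> \<Longrightarrow>
    y \<in> cyl S U \<longleftrightarrow> y \<in> amalgam_points X \<S> Y \<and> proj y \<in> S \<and> the (y S) \<in> U"
  using dom_proj[of y] unfolding amalgam_cylinder_def by blast

lemma section_in_cyl_iff:
  assumes "p \<in> topspace X" "selection z" "S \<in> \<S>"
  shows "\<sigma> z p \<in> cyl S U \<longleftrightarrow> p \<in> S \<and> z S \<in> U"
  using assms by (auto simp: in_cyl_iff proj_section section_in_points) (auto simp: amalgam_section_def)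

lemma continuous_map_proj: "continuous_map Z X proj"
proof (rule continuous_map_into_subbase_of[OF subbase])
  fix S assume S: "S \<in> \<S>"
  have "{y \<in> topspace Z. proj y \<in> S} = cyl S (topspace (Y S))"
    using S by (auto simp: topspace_amalgam in_cyl_iff value_in)
  then show "openin Z {y \<in> topspace Z. proj y \<in> S}"
    using S openin_amalgam_cylinder by (metis openin_topspace)
qed (simp add: topspace_amalgam proj_in)

lemma openin_proj_vimage: "openin X U \<Longrightarrow> openin Z {y \<in> amalgam_points X \<S> Y. proj y \<in> U}"
  using openin_continuous_map_preimage[OF continuous_map_proj] by (simp add: topspace_amalgam)

lemma points_eqI:
  assumes "y \<in> amalgam_points X \<S> Y" "y' \<in> amalgam_points X \<S> Y" "proj y = proj y'"
    and "\<And>S. \<lbrakk>S \<in> \<S>; proj y \<in> S\<rbrakk> \<Longrightarrow> the (y S) = the (y' S)"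
  shows "y = y'"
proof
  fix S
  have "S \<in> dom y \<longleftrightarrow> S \<in> dom y'" "S \<in> dom y \<Longrightarrow> the (y S) = the (y' S)"
    using assms by (auto simp: dom_proj)
  then show "y S = y' S"
    by (metis domIff option.expand)
qed

subsection \<open>Connectedness\<close>

text \<open>Along a section the coordinate at \<open>S\<close> is the constant \<open>z S\<close>,
  so the preimage of a cylinder over \<open>S\<close> is \<open>S\<close> or empty.\<close>

lemma continuous_map_section:
  assumes z: "selection z"
  shows "continuous_map X Z (\<sigma> z)"
proof (rule continuous_map_into_subbase_of[OF subbase_of_amalgam])
  fix B assume "B \<in> {cyl S U |S U. S \<in> \<S> \<and> openin (Y S) U}"
  then obtain S U where B: "B = cyl S U" "S \<in> \<S>" "openin (Y S) U" by blast
  have "{p \<in> topspace X. \<sigma> z p \<in> B} = (if z S \<in> U then S else {})"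
    using B z openin_subset[OF openin_base[of S]] by (auto simp: section_in_cyl_iff)
  then show "openin X {p \<in> topspace X. \<sigma> z p \<in> B}"
    using B openin_base by auto
qed (simp add: topspace_amalgam section_in_points z)

text \<open>Only the coordinate at \<open>T\<close> varies, so the factor \<open>Y T\<close> is
  mapped into the fibre over \<open>p\<close>. This transfers connectedness of a factor to the
  amalgam.\<close>

lemma continuous_map_section_update:
  assumes z: "selection z" and p: "p \<in> topspace X" and T: "T \<in> \<S>"
  shows "continuous_map (Y T) Z (\<lambda>u. \<sigma> (z(T := u)) p)"
proof (rule continuous_map_into_subbase_of[OF subbase_of_amalgam])
  fix B assume "B \<in> {cyl S U |S U. S \<in> \<S> \<and> openin (Y S) U}"
  then obtain S U where B: "B = cyl S U" "S \<in> \<S>" "openin (Y S) U" by blast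
  have "{u \<in> topspace (Y T). \<sigma> (z(T := u)) p \<in> B}
      = (if p \<notin> S then {} else if S = T then U else if z S \<in> U then topspace (Y T) else {})"
  proof -
    have "\<sigma> (z(T := u)) p \<in> B \<longleftrightarrow> p \<in> S \<and> (z(T := u)) S \<in> U" if "u \<in> topspace (Y T)" for u
      unfolding B(1) using z p B(2) that by (intro section_in_cyl_iff) auto
    then show ?thesis
      using openin_subset[OF B(3)] by (cases "S = T") auto
  qed
  then show "openin (Y T) {u \<in> topspace (Y T). \<sigma> (z(T := u)) p \<in> B}"
    using B by auto
qed (use assms in \<open>auto simp: topspace_amalgam intro!: section_in_points\<close>)

lemma connected_component_section:
  assumes "connected_space X" "selection z" "p \<in> topspace X" "q \<in> topspace X"
  shows "connected_component_of Z (\<sigma> z p) (\<sigma> z q)"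
  using connectedin_continuous_map_image[OF continuous_map_section[OF assms(2)], of "topspace X"]
    assms(1,3,4) unfolding connected_component_of_def connectedin_topspace by blast

text \<open>If \<open>T\<close> is not the whole base space, then the two sections agree outside \<open>T\<close>; otherwise
  they are joined through a copy of the factor over \<open>T\<close>.\<close>

lemma connected_component_section_update:
  assumes X: "connected_space X" and p: "p \<in> topspace X"
    and z: "selection z" and T: "T \<in> \<S>" and u: "u \<in> topspace (Y T)"
    and top: "T = topspace X \<Longrightarrow> connected_space (Y T)"
  shows "connected_component_of Z (\<sigma> z p) (\<sigma> (z(T := u)) p)"
proof (cases "T = topspace X")
  case True
  let ?h = "\<lambda>u. \<sigma> (z(T := u)) p"
  have "connectedin Z (?h ` topspace (Y T))"
    using connectedin_continuous_map_image[OF continuous_map_section_update[OF z p T]] top[OF True]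
    by (simp add: connectedin_topspace)
  moreover have "?h (z T) \<in> ?h ` topspace (Y T)" "?h u \<in> ?h ` topspace (Y T)"
    using z T u by blast+
  ultimately show ?thesis
    unfolding connected_component_of_def by (metis fun_upd_triv)
next
  case False
  then obtain q where q: "q \<in> topspace X" "q \<notin> T"
    using openin_subset[OF openin_base[OF T]] by blast
  have z': "selection (z(T := u))"
    using z u by auto
  have "\<sigma> z q = \<sigma> (z(T := u)) q"
    using q(2) by (auto simp: amalgam_section_def)
  then show ?thesis
    using connected_component_section[OF X z p q(1)] connected_component_section[OF X z' q(1) p]
    by (metis connected_component_of_trans)
qed

lemma connected_space_amalgam:
  assumes X: "connected_space X"
    and top: "topspace X \<in> \<S> \<Longrightarrow> connected_space (Y (topspace X))"
  shows "connected_space Z"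
proof -
  \<comment> \<open>The induction turns \<open>z\<close> into \<open>w\<close> one coordinate at a
    time; \<open>z\<close> stays arbitrary because each step replaces it.\<close>
  have finite_change: "connected_component_of Z (\<sigma> z p) (\<sigma> w p)"
    if "finite D" "selection z" "selection w" "p \<in> topspace X" "\<forall>S. S \<notin> D \<longrightarrow> w S = z S" "D \<subseteq> \<S>" for D z w p
    using that
  proof (induction D arbitrary: z)
    case empty
    then have "w = z" by auto
    then show ?case
      using empty by (simp add: connected_component_of_refl topspace_amalgam section_in_points)
  next
    case (insert T D)
    then have "connected_component_of Z (\<sigma> z p) (\<sigma> (z(T := w T)) p)"
      using X top by (intro connected_component_section_update) auto
    moreover have "connected_component_of Z (\<sigma> (z(T := w T)) p) (\<sigma> w p)"
      using insert.prems by (intro insert.IH) auto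
    ultimately show ?case by (rule connected_component_of_trans)
  qed
  have "connected_component_of Z y y'" if y: "y \<in> topspace Z" and y': "y' \<in> topspace Z" for y y'
  proof -
    obtain z p where z: "p \<in> topspace X" "selection z" "y = \<sigma> z p"
      using points_cases y unfolding topspace_amalgam by metis
    obtain w q where w: "q \<in> topspace X" "selection w" "y' = \<sigma> w q"
      using points_cases y' unfolding topspace_amalgam by metis
    \<comment> \<open>Components are closed, so it suffices that the component of \<open>y\<close>
      meets every neighbourhood of \<open>y'\<close>.\<close>
    have "y' \<in> Z closure_of (connected_component_of_set Z y)"
      unfolding in_closure_of
    proof (intro conjI y' allI impI)
      fix V assume V: "y' \<in> V \<and> openin Z V"
      then obtain D where D: "finite D" "D \<subseteq> dom y'"
          and agree: "\<And>x. \<lbrakk>x \<in> amalgam_points X \<S> Y; \<And>S. S \<in> D \<Longrightarrow> x S = y' S\<rbrakk> \<Longrightarrow> x \<in> V"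
        using amalgam_nhd_agree by metis
      \<comment> \<open>\<open>v\<close> has the values of \<open>w\<close> at the finitely many
        tested coordinates and those of \<open>z\<close> elsewhere, so it is a finite change of
        \<open>z\<close>.\<close>
      define v where "v S = (if S \<in> D then w S else z S)" for S
      have v: "selection v"
        using z w by (auto simp: v_def)
      have "connected_component_of Z y (\<sigma> z q)"
        using connected_component_section[OF X] z w by auto
      moreover have "connected_component_of Z (\<sigma> z q) (\<sigma> v q)"
        using D z w v by (intro finite_change[of D]) (auto simp: v_def dom_amalgam_section)
      ultimately have "connected_component_of Z y (\<sigma> v q)"
        by (rule connected_component_of_trans)
      moreover have "\<sigma> v q \<in> V"
        using v w by (intro agree section_in_points) (auto simp: amalgam_section_def v_def)
      ultimately show "\<exists>x. x \<in> connected_component_of_set Z y \<and> x \<in> V" by auto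
    qed
    moreover have "closedin Z (connected_component_of_set Z y)"
      by (rule closedin_connected_component_of)
    ultimately show ?thesis
      by (metis closure_of_eq mem_Collect_eq)
  qed
  then show ?thesis
    by (auto simp: connected_space_iff_connected_component)
qed

subsection \<open>Separation axioms\<close>

text \<open>Points over different base points are separated in the base. Points over the same base
  point have the same domain, so they differ at some coordinate and a cylinder over it separates
  them. The Hausdorff case divides in the same way.\<close>

lemma t1_space_amalgam:
  assumes X: "t1_space X" and Y: "\<And>S. S \<in> \<S> \<Longrightarrow> t1_space (Y S)"
  shows "t1_space Z"
  unfolding t1_space_def topspace_amalgam
proof (intro ballI impI)
  fix y y' assume y: "y \<in> amalgam_points X \<S> Y" "y' \<in> amalgam_points X \<S> Y" "y \<noteq> y'"
  show "\<exists>U. openin Z U \<and> y \<in> U \<and> y' \<notin> U"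
  proof (cases "proj y = proj y'")
    case False
    then obtain U where "openin X U" "proj y \<in> U" "proj y' \<notin> U"
      using X y proj_in unfolding t1_space_def by metis
    with y show ?thesis
      using openin_proj_vimage by (intro exI[of _ "{y \<in> amalgam_points X \<S> Y. proj y \<in> U}"]) auto
  next
    case True
    then obtain S where S: "S \<in> \<S>" "proj y \<in> S" "the (y S) \<noteq> the (y' S)"
      using points_eqI y by metis
    then obtain U where "openin (Y S) U" "the (y S) \<in> U" "the (y' S) \<notin> U"
      using Y[OF S(1)] value_in y True unfolding t1_space_def by metis
    with y S True show ?thesis
      using openin_amalgam_cylinder[of S \<S> Y U X] by (intro exI[of _ "cyl S U"]) (auto simp: in_cyl_iff)
  qed
qed

lemma Hausdorff_space_amalgam:
  assumes X: "Hausdorff_space X" and Y: "\<And>S. S \<in> \<S> \<Longrightarrow> Hausdorff_space (Y S)"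
  shows "Hausdorff_space Z"
  unfolding Hausdorff_space_def topspace_amalgam
proof (intro allI impI, elim conjE)
  fix y y' assume y: "y \<in> amalgam_points X \<S> Y" "y' \<in> amalgam_points X \<S> Y" "y \<noteq> y'"
  show "\<exists>U V. openin Z U \<and> openin Z V \<and> y \<in> U \<and> y' \<in> V \<and> disjnt U V"
  proof (cases "proj y = proj y'")
    case False
    then obtain U V where "openin X U" "openin X V" "proj y \<in> U" "proj y' \<in> V" "disjnt U V"
      using X y proj_in unfolding Hausdorff_space_def by metis
    with y show ?thesis
      using openin_proj_vimage
      by (intro exI[of _ "{y \<in> amalgam_points X \<S> Y. proj y \<in> U}"]
                exI[of _ "{y \<in> amalgam_points X \<S> Y. proj y \<in> V}"]) (auto simp: disjnt_iff)
  next
    case True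
    then obtain S where S: "S \<in> \<S>" "proj y \<in> S" "the (y S) \<noteq> the (y' S)"
      using points_eqI y by metis
    then obtain U V where "openin (Y S) U" "openin (Y S) V" "the (y S) \<in> U" "the (y' S) \<in> V" "disjnt U V"
      using Y[OF S(1)] value_in y True unfolding Hausdorff_space_def by metis
    with y S True show ?thesis
      using openin_amalgam_cylinder[of S \<S> Y _ X]
      by (intro exI[of _ "cyl S U"] exI[of _ "cyl S V"]) (auto simp: in_cyl_iff disjnt_iff)
  qed
qed

text \<open>A cylinder over \<open>S\<close> with a closed value set need not be closed, since
  \<open>S\<close> is only open. Restricting it to the points over a closed
  \<open>K \<subseteq> S\<close> repairs this.\<close>

lemma regular_space_amalgam:
  assumes X: "regular_space X" and Y: "\<And>S. S \<in> \<S> \<Longrightarrow> regular_space (Y S)"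
  shows "regular_space Z"
proof (rule regular_space_subbase_of[OF subbase_of_amalgam])
  fix B y assume "B \<in> {cyl S U |S U. S \<in> \<S> \<and> openin (Y S) U}" "y \<in> B"
  then obtain S U where S: "S \<in> \<S>" "openin (Y S) U" and B: "B = cyl S U" "y \<in> cyl S U"
    by blast
  then have y: "y \<in> amalgam_points X \<S> Y" "proj y \<in> S" "the (y S) \<in> U"
    by (auto simp: in_cyl_iff)
  obtain G K where G: "openin X G" "closedin X K" "proj y \<in> G" "G \<subseteq> K" "K \<subseteq> S"
    using X openin_base[OF S(1)] y(2)
    unfolding neighbourhood_base_of_closedin [symmetric] neighbourhood_base_of by metis
  obtain V C where V: "openin (Y S) V" "closedin (Y S) C" "the (y S) \<in> V" "V \<subseteq> C" "C \<subseteq> U"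
    using Y[OF S(1)] S(2) y(3)
    unfolding neighbourhood_base_of_closedin [symmetric] neighbourhood_base_of by metis
  let ?U = "cyl S V \<inter> {y \<in> amalgam_points X \<S> Y. proj y \<in> G}"
  let ?C = "cyl S C \<inter> {y \<in> amalgam_points X \<S> Y. proj y \<in> K}"
  \<comment> \<open>Because \<open>K \<subseteq> S\<close>, a point not over \<open>S\<close>
    already lies over the complement of \<open>K\<close>.\<close>
  have "topspace Z - ?C = cyl S (topspace (Y S) - C) \<union> {y \<in> amalgam_points X \<S> Y. proj y \<in> topspace X - K}"
    using S(1) G(5) by (auto simp: in_cyl_iff topspace_amalgam proj_in value_in)
  moreover have "openin Z (cyl S (topspace (Y S) - C) \<union> {y \<in> amalgam_points X \<S> Y. proj y \<in> topspace X - K})"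
    using S(1) V(2) G(2) by (intro openin_Un openin_amalgam_cylinder openin_proj_vimage) auto
  ultimately have "closedin Z ?C"
    by (auto simp: closedin_def topspace_amalgam)
  moreover have "openin Z ?U"
    using S(1) V(1) G(1) by (intro openin_Int openin_amalgam_cylinder openin_proj_vimage) auto
  ultimately show "\<exists>U C. openin Z U \<and> closedin Z C \<and> y \<in> U \<and> U \<subseteq> C \<and> C \<subseteq> B"
    using y G V S(1) by (intro exI[of _ ?U] exI[of _ ?C]) (auto simp: in_cyl_iff B(1))
qed

lemma completely_regular_space_amalgam:
  assumes X: "completely_regular_space X" and Y: "\<And>S. S \<in> \<S> \<Longrightarrow> completely_regular_space (Y S)"
  shows "completely_regular_space Z"
proof (rule completely_regular_space_subbase_of[OF subbase_of_amalgam])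
  fix B y assume "B \<in> {cyl S U |S U. S \<in> \<S> \<and> openin (Y S) U}" "y \<in> B"
  then obtain S U where S: "S \<in> \<S>" "openin (Y S) U" and B: "B = cyl S U" "y \<in> cyl S U"
    by blast
  then have y: "y \<in> amalgam_points X \<S> Y" "proj y \<in> S" "the (y S) \<in> U"
    by (auto simp: in_cyl_iff)
  have "closedin X (topspace X - S)" "proj y \<in> topspace X - (topspace X - S)"
    using openin_base[OF S(1)] y proj_in by auto
  then obtain f where f: "continuous_map X (top_of_set {0..1::real}) f" "f (proj y) = 0" "f ` (topspace X - S) \<subseteq> {1}"
    using X unfolding completely_regular_space_def by blast
  have "closedin (Y S) (topspace (Y S) - U)" "the (y S) \<in> topspace (Y S) - (topspace (Y S) - U)"
    using y value_in S by auto
  then obtain g where g: "continuous_map (Y S) (top_of_set {0..1::real}) g" "g (the (y S)) = 0"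
      "g ` (topspace (Y S) - U) \<subseteq> {1}"
    using Y[OF S(1)] unfolding completely_regular_space_def by blast
  have f_open: "openin X {p \<in> topspace X. f p > a}" "openin X {p \<in> topspace X. f p < a}" for a
    using f(1) unfolding continuous_map_upper_lower_semicontinuous_lt_gen by auto
  have g_open: "openin (Y S) {u \<in> topspace (Y S). g u > a}" "openin (Y S) {u \<in> topspace (Y S). g u < a}" for a
    using g(1) unfolding continuous_map_upper_lower_semicontinuous_lt_gen by auto
  have f_le: "f p \<le> 1" if "p \<in> topspace X" for p
    using f(1) that by (auto simp: continuous_map_in_subtopology)
  have g_le: "g u \<le> 1" if "u \<in> topspace (Y S)" for u
    using g(1) that by (auto simp: continuous_map_in_subtopology)
  have f_out: "f p = 1" if "p \<in> topspace X" "p \<notin> S" for p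
    using f(3) that by auto
  \<comment> \<open>The value 1 off \<open>S\<close> fits continuously, because \<open>f\<close> is
    already 1 there and \<open>h\<close> never exceeds 1.\<close>
  define h where "h x = max (f (proj x)) (if proj x \<in> S then g (the (x S)) else 1)" for x
  have h_le: "h x \<le> 1" if "x \<in> amalgam_points X \<S> Y" for x
    using that f_le g_le value_in[OF that S(1)] proj_in by (auto simp: h_def)
  have "continuous_map Z euclideanreal h"
    unfolding continuous_map_upper_lower_semicontinuous_lt
  proof (intro conjI allI)
    fix a
    show "openin Z {x \<in> topspace Z. h x > a}"
    proof (cases "a < 1")
      case True
      \<comment> \<open>Points not over \<open>S\<close> fall into the first set, since
        \<open>f\<close> is 1 there.\<close>
      then have "{x \<in> topspace Z. h x > a} =
          {x \<in> amalgam_points X \<S> Y. proj x \<in> {p \<in> topspace X. f p > a}} \<union> cyl S {u \<in> topspace (Y S). g u > a}"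
        using S(1) f_out
        by (auto simp: h_def topspace_amalgam in_cyl_iff proj_in value_in less_max_iff_disj split: if_splits)
      then show ?thesis
        by (simp only: openin_Un openin_amalgam_cylinder openin_proj_vimage S(1) f_open g_open)
    next
      case False
      then have "{x \<in> topspace Z. h x > a} = {}"
        using h_le by (force simp: topspace_amalgam)
      then show ?thesis by (simp only: openin_empty openin_topspace)
    qed
    show "openin Z {x \<in> topspace Z. h x < a}"
    proof (cases "a \<le> 1")
      case True
      \<comment> \<open>Points not over \<open>S\<close> have \<open>h\<close> at least 1, hence at
        least \<open>a\<close>, so only points over \<open>S\<close> remain.\<close>
      then have "{x \<in> topspace Z. h x < a} =
          {x \<in> amalgam_points X \<S> Y. proj x \<in> {p \<in> topspace X. f p < a}} \<inter> cyl S {u \<in> topspace (Y S). g u < a}"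
        using S(1)
        by (auto simp: h_def topspace_amalgam in_cyl_iff proj_in value_in split: if_splits)
      then show ?thesis
        by (simp only: openin_Int openin_amalgam_cylinder openin_proj_vimage S(1) f_open g_open)
    next
      case False
      then have "{x \<in> topspace Z. h x < a} = topspace Z"
        using h_le by (force simp: topspace_amalgam)
      then show ?thesis by (simp only: openin_empty openin_topspace)
    qed
  qed
  moreover have "h y = 0"
    using f g y by (simp add: h_def)
  moreover have "h x \<ge> 1" if "x \<in> topspace Z - B" for x
    using that f_out S g(3) value_in[of x S]
    by (auto simp: h_def B in_cyl_iff topspace_amalgam le_max_iff_disj image_subset_iff)
  ultimately show "\<exists>h. continuous_map Z euclideanreal h \<and> h y = 0 \<and> (\<forall>x\<in>topspace Z - B. h x \<ge> 1)"
    by blast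
qed

lemma T_space_amalgam:
  assumes "T_space i X" and "\<And>S. S \<in> \<S> \<Longrightarrow> T_space i (Y S)"
  shows "T_space i Z"
  using assms
  by (cases i) (auto intro: t1_space_amalgam Hausdorff_space_amalgam regular_space_amalgam
      completely_regular_space_amalgam)

end

section \<open>Extending the base space\<close>

lemma T_space_imp_t1: "T_space i X \<Longrightarrow> t1_space X"
  by (cases i) (auto simp: Hausdorff_imp_t1_space)

lemma T_space_singleton: "T_space i (discrete_topology {c})"
  by (cases i) (auto simp: t1_space_def Hausdorff_space_def completely_regular_space_discrete_topology)

text \<open>The image of \<open>S\<close> is relatively open in the image of \<open>X\<close>, hence
  the trace of an open set of \<open>W\<close>; injectivity turns this into an equation of
  preimages.\<close>

lemma embedding_map_extend_open:
  assumes f: "embedding_map X W f" and S: "openin X S"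
  obtains T where "openin W T" "{x \<in> topspace X. f x \<in> T} = S"
proof -
  have hom: "homeomorphic_map X (subtopology W (f ` topspace X)) f"
    using f by (simp add: embedding_map_def)
  then have "openin (subtopology W (f ` topspace X)) (f ` S)"
    using S openin_subset homeomorphic_map_openness by metis
  then obtain T where T: "openin W T" "f ` S = T \<inter> f ` topspace X"
    by (auto simp: openin_subtopology)
  moreover have "inj_on f (topspace X)" "S \<subseteq> topspace X"
    using hom S openin_subset by (auto simp: homeomorphic_imp_injective_map)
  ultimately have "{x \<in> topspace X. f x \<in> T} = S"
    by (fastforce dest: inj_onD)
  with T(1) that show thesis by blast
qed

text \<open>The embedding relabels each coordinate \<open>S\<close> as \<open>e S\<close> and fills
  every other coordinate with the single point of its factor. Cylinders over the added coordinates
  merely test the base point, which moves by the continuous map \<open>f\<close>.\<close>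

lemma dense_embedding_amalgam:
  fixes X :: "'a topology" and Y :: "'a set \<Rightarrow> 'b topology" and W :: "'c topology"
  assumes "amalgam_system X \<S> Y" "amalgam_system W \<T> Y'"
    and f: "dense_embedding X W f"
    and e: "\<And>S. S \<in> \<S> \<Longrightarrow> e S \<in> \<T> \<and> {x \<in> topspace X. f x \<in> e S} = S \<and> Y' (e S) = Y S"
    and singleton: "\<And>T. T \<in> \<T> - e ` \<S> \<Longrightarrow> topspace (Y' T) = {c}"
  shows "\<exists>F. dense_embedding (amalgam X \<S> Y) (amalgam W \<T> Y') F"
proof -
  interpret A: amalgam_system X \<S> Y by fact
  interpret B: amalgam_system W \<T> Y' by fact
  have emb: "embedding_map X W f" and dense: "W closure_of (f ` topspace X) = topspace W"
    using f by (auto simp: dense_embedding_def)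
  have cont: "continuous_map X W f" and inj: "inj_on f (topspace X)"
    using emb unfolding embedding_map_def
    by (auto simp: homeomorphic_imp_continuous_map homeomorphic_imp_injective_map
        dest: homeomorphic_imp_continuous_map continuous_map_into_fulltopology)
  have f_in: "f x \<in> topspace W" if "x \<in> topspace X" for x
    using cont that by (auto simp: continuous_map_def)
  have f_e: "f x \<in> e S \<longleftrightarrow> x \<in> S" if "x \<in> topspace X" "S \<in> \<S>" for x S
    using e[OF that(2)] that(1) by blast
  define pre where "pre T = {x \<in> topspace X. f x \<in> T}" for T
  have pre_e: "pre (e S) = S" if "S \<in> \<S>" for S
    using e[OF that] by (simp add: pre_def)
  \<comment> \<open>The default supplies the single point of an added factor. For
    \<open>T = e S\<close> with \<open>S\<close> outside the domain of \<open>y\<close> it is never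
    seen, since \<open>f\<close> then sends the base point of \<open>y\<close> outside
    \<open>T\<close>.\<close>
  define ext where "ext y T = (if T \<in> e ` \<S> \<and> pre T \<in> dom y then the (y (pre T))
      else (SOME u. u \<in> topspace (Y' T)))" for y :: "'a set \<rightharpoonup> 'b" and T
  define F where "F y = amalgam_section \<T> (ext y) (f (A.proj y))" for y
  \<comment> \<open>Reading back the coordinates \<open>e S\<close> inverts \<open>F\<close> on its
    image.\<close>
  define G :: "('c set \<rightharpoonup> 'b) \<Rightarrow> ('a set \<rightharpoonup> 'b)"
    where "G w = (\<lambda>S. if S \<in> \<S> then w (e S) else None)" for w
  have ext_sel: "B.selection (ext y)" if y: "y \<in> amalgam_points X \<S> Y" for y
  proof
    fix T assume T: "T \<in> \<T>"
    show "ext y T \<in> topspace (Y' T)"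
    proof (cases "T \<in> e ` \<S> \<and> pre T \<in> dom y")
      case True
      then show ?thesis
        using y e pre_e A.dom_proj[OF y] A.value_in[OF y] by (auto simp: ext_def)
    next
      case False
      then have "ext y T = (SOME u. u \<in> topspace (Y' T))"
        by (simp only: ext_def if_False)
      then show ?thesis
        using B.factor_nonempty[OF T] by (simp add: some_in_eq)
    qed
  qed
  have F_in: "F y \<in> amalgam_points W \<T> Y'" if "y \<in> amalgam_points X \<S> Y" for y
    unfolding F_def using that by (intro B.section_in_points ext_sel f_in A.proj_in)
  have proj_F: "B.proj (F y) = f (A.proj y)" if "y \<in> amalgam_points X \<S> Y" for y
    unfolding F_def using that by (intro B.proj_section f_in A.proj_in)
  have F_e: "F y (e S) = y S" if y: "y \<in> amalgam_points X \<S> Y" and S: "S \<in> \<S>" for y S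
  proof (cases "A.proj y \<in> S")
    case True
    then have "S \<in> dom y" "f (A.proj y) \<in> e S"
      using A.dom_proj[OF y] S f_e[OF A.proj_in[OF y]] by auto
    then show ?thesis
      using e[OF S] S by (auto simp: F_def amalgam_section_def ext_def pre_e)
  next
    case False
    then have "y S = None" "f (A.proj y) \<notin> e S"
      using A.dom_proj[OF y] S f_e[OF A.proj_in[OF y]] by auto
    then show ?thesis
      by (simp add: F_def amalgam_section_def)
  qed
  have G_F: "G (F y) = y" if y: "y \<in> amalgam_points X \<S> Y" for y
    using F_e[OF y] A.dom_proj[OF y] by (fastforce simp: G_def fun_eq_iff domIff)
  have F_cyl: "F y \<in> B.cyl (e S) U \<longleftrightarrow> y \<in> A.cyl S U" if "y \<in> amalgam_points X \<S> Y" "S \<in> \<S>" for y S U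
    using that F_in F_e by (simp add: amalgam_cylinder_def domIff)
  have contF: "continuous_map A.Z B.Z F"
  proof (rule continuous_map_into_subbase_of[OF subbase_of_amalgam])
    fix V assume "V \<in> {B.cyl T U |T U. T \<in> \<T> \<and> openin (Y' T) U}"
    then obtain T U where V: "V = B.cyl T U" "T \<in> \<T>" "openin (Y' T) U" by blast
    show "openin A.Z {y \<in> topspace A.Z. F y \<in> V}"
    proof (cases "T \<in> e ` \<S>")
      case True
      then obtain S where S: "S \<in> \<S>" "T = e S" by blast
      then have "{y \<in> topspace A.Z. F y \<in> V} = A.cyl S U"
        using F_cyl V by (auto simp: topspace_amalgam) (auto simp: amalgam_cylinder_def)
      then show ?thesis
        using V S e openin_amalgam_cylinder[of S \<S> Y U X] by auto
    next
      case False
      \<comment> \<open>This coordinate is constantly \<open>c\<close>, so the cylinder either only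
        requires the base point to lie in \<open>T\<close> or is empty.\<close>
      then have T: "topspace (Y' T) = {c}"
        using singleton V(2) by blast
      have "the (F y T) = c" if "y \<in> amalgam_points X \<S> Y" "f (A.proj y) \<in> T" for y
        using B.value_in[OF F_in[OF that(1)] V(2)] proj_F that T by auto
      then have "{y \<in> topspace A.Z. F y \<in> V}
          = (if c \<in> U then {y \<in> amalgam_points X \<S> Y. A.proj y \<in> pre T} else {})"
        using V(2) F_in proj_F A.proj_in by (auto simp: V(1) topspace_amalgam B.in_cyl_iff pre_def)
      moreover have "openin X (pre T)"
        unfolding pre_def using openin_continuous_map_preimage[OF cont B.openin_base[OF V(2)]] .
      ultimately show ?thesis
        using A.openin_proj_vimage by auto
    qed
  qed (simp add: topspace_amalgam F_in)
  have contG: "continuous_map (subtopology B.Z (F ` topspace A.Z)) A.Z G"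
  proof (rule continuous_map_into_subbase_of[OF subbase_of_amalgam])
    fix V assume "V \<in> {A.cyl S U |S U. S \<in> \<S> \<and> openin (Y S) U}"
    then obtain S U where V: "V = A.cyl S U" "S \<in> \<S>" "openin (Y S) U" by blast
    have "{w \<in> topspace (subtopology B.Z (F ` topspace A.Z)). G w \<in> V} = B.cyl (e S) U \<inter> F ` topspace A.Z"
      using V F_cyl G_F F_in by (auto simp: topspace_amalgam)
    moreover have "openin B.Z (B.cyl (e S) U)"
      using V e[of S] by (intro openin_amalgam_cylinder) auto
    ultimately show "openin (subtopology B.Z (F ` topspace A.Z))
        {w \<in> topspace (subtopology B.Z (F ` topspace A.Z)). G w \<in> V}"
      by (auto simp: openin_subtopology)
  qed (auto simp: topspace_amalgam G_F)
  have "homeomorphic_maps A.Z (subtopology B.Z (F ` topspace A.Z)) F G"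
    unfolding homeomorphic_maps_def
    using contF contG G_F by (auto simp: continuous_map_in_subtopology topspace_amalgam)
  then have "embedding_map A.Z B.Z F"
    unfolding embedding_map_def homeomorphic_map_maps by blast
  moreover have "B.Z closure_of (F ` topspace A.Z) = topspace B.Z"
    unfolding dense_intersects_open
  proof (intro allI impI, elim conjE)
    fix V assume V: "openin B.Z V" "V \<noteq> {}"
    then obtain w where w: "w \<in> V" by blast
    then have w_in: "w \<in> amalgam_points W \<T> Y'"
      using openin_subset[OF V(1)] by (auto simp: topspace_amalgam)
    then obtain z q where z: "q \<in> topspace W" "B.selection z" "w = amalgam_section \<T> z q"
      using B.points_cases by metis
    obtain D where D: "finite D" "D \<subseteq> dom w"
        "\<And>x. \<lbrakk>x \<in> amalgam_points W \<T> Y'; \<And>S. S \<in> D \<Longrightarrow> x S = w S\<rbrakk> \<Longrightarrow> x \<in> V"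
      using amalgam_nhd_agree[OF V(1) w] by metis
    have D': "T \<in> \<T>" "q \<in> T" if "T \<in> D" for T
      using D(2) that z(3) by (auto simp: dom_amalgam_section)
    \<comment> \<open>The finitely many tested sets all contain \<open>q\<close>, so density of the
      image of \<open>X\<close> allows \<open>q\<close> to be replaced by some \<open>f p\<close>
      that still lies in all of them.\<close>
    then have "openin W (\<Inter>(insert (topspace W) D))"
      using D(1) B.openin_base by (intro openin_Inter) auto
    moreover have "q \<in> \<Inter>(insert (topspace W) D)"
      using D' z(1) by auto
    ultimately have "f ` topspace X \<inter> \<Inter>(insert (topspace W) D) \<noteq> {}"
      using dense unfolding dense_intersects_open by blast
    then obtain p where p: "p \<in> topspace X" "\<And>T. T \<in> D \<Longrightarrow> f p \<in> T"
      by blast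
    \<comment> \<open>\<open>z \<circ> e\<close> pulls the selection over \<open>W\<close> back to
      the original factors. The image of \<open>y\<close> under \<open>F\<close> is then the section
      of \<open>z\<close> at \<open>f p\<close>, which agrees with \<open>w\<close> on
      \<open>D\<close>.\<close>
    define y where "y = amalgam_section \<S> (z \<circ> e) p"
    have y: "y \<in> amalgam_points X \<S> Y"
      unfolding y_def using p(1) z(2) e by (intro A.section_in_points) fastforce+
    have proj_y: "A.proj y = p"
      unfolding y_def using p(1) by (rule A.proj_section)
    let ?w = "amalgam_section \<T> z (f p)"
    have w'_in: "?w \<in> amalgam_points W \<T> Y'"
      using z(2) f_in[OF p(1)] by (intro B.section_in_points)
    have proj_w': "B.proj ?w = f p"
      using f_in[OF p(1)] by (rule B.proj_section)
    have "F y = ?w"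
    proof (rule B.points_eqI[OF F_in[OF y] w'_in])
      show "B.proj (F y) = B.proj ?w"
        using proj_F[OF y] proj_y proj_w' by simp
      fix T assume T: "T \<in> \<T>" "B.proj (F y) \<in> T"
      show "the (F y T) = the (?w T)"
      proof (cases "T \<in> e ` \<S>")
        case True
        then obtain S where S: "S \<in> \<S>" "T = e S" by blast
        then have "p \<in> S" "f p \<in> e S"
          using T(2) proj_F[OF y] proj_y f_e[OF p(1)] by auto
        then show ?thesis
          using S T(1) F_e[OF y] by (auto simp: y_def amalgam_section_def)
      next
        case False
        then show ?thesis
          using B.value_in[OF F_in[OF y] T] B.value_in[OF w'_in T(1)] T(2)
            proj_F[OF y] proj_y proj_w' singleton[of T] T(1) by auto
      qed
    qed
    moreover have "?w \<in> V"
      using p(2) D' by (intro D(3) w'_in) (auto simp: z(3) amalgam_section_def)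
    ultimately show "F ` topspace A.Z \<inter> V \<noteq> {}"
      using y by (auto simp: topspace_amalgam)
  qed
  ultimately show ?thesis
    by (auto simp: dense_embedding_def)
qed

text \<open>Only the whole space can extend to the whole connectification, and deleting a point outside
  the image of a non-surjective embedding avoids even this.\<close>

lemma extend_subbase:
  assumes f: "embedding_map X W f" and W: "t1_space W" and \<S>: "\<And>S. S \<in> \<S> \<Longrightarrow> openin X S"
    and top: "topspace X \<in> \<S> \<Longrightarrow> f ` topspace X \<noteq> topspace W \<or> P (topspace X)"
  obtains e where "\<And>S. S \<in> \<S> \<Longrightarrow> openin W (e S) \<and> {x \<in> topspace X. f x \<in> e S} = S"
    and "\<And>S. \<lbrakk>S \<in> \<S>; e S = topspace W\<rbrakk> \<Longrightarrow> P S"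
proof -
  have sub: "f ` topspace X \<subseteq> topspace W"
    using f unfolding embedding_map_def
    by (metis homeomorphic_imp_surjective_map topspace_subtopology inf_le1)
  have "\<exists>T. openin W T \<and> {x \<in> topspace X. f x \<in> T} = S \<and> (T = topspace W \<longrightarrow> P S)" if S: "S \<in> \<S>" for S
  proof (cases "S = topspace X \<and> \<not> P S")
    case True
    then obtain w where w: "w \<in> topspace W" "w \<notin> f ` topspace X"
      using top S sub by blast
    then have "openin W (topspace W - {w})"
      using W by (simp add: closedin_t1_singleton openin_diff)
    with w sub True show ?thesis
      by (intro exI[of _ "topspace W - {w}"]) auto
  next
    case False
    obtain T where T: "openin W T" "{x \<in> topspace X. f x \<in> T} = S"
      using embedding_map_extend_open[OF f \<S>[OF S]] by metis
    then have "T = topspace W \<longrightarrow> S = topspace X"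
      using sub by auto
    with T False show ?thesis
      by blast
  qed
  then show thesis
    using that by metis
qed

section \<open>The connectification of the amalgam\<close>

theorem corollary3p5:
  fixes X :: "'a topology"
    and \<S> :: "'a set set"
    and Y :: "'a set \<Rightarrow> 'b topology"
    and i :: separation_index
  assumes "topspace X \<noteq> {}" and "t0_space X"
    and "subbase_of X \<S>" and "{} \<notin> \<S>"
    and "\<And>S. S \<in> \<S> \<Longrightarrow> topspace (Y S) \<noteq> {}"
    and "\<exists>W :: 'c topology. connectification X W \<and> T_space i W"
    and "\<And>S. S \<in> \<S> \<Longrightarrow> T_space i (Y S)"
    and "(\<exists>W :: 'c topology. proper_connectification X W \<and> T_space i W) \<or>
         topspace X \<notin> \<S> \<or>
         (topspace X \<in> \<S> \<and> connected_space (Y (topspace X)))"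
  shows "\<exists>Z :: ('c set \<rightharpoonup> 'b) topology. connectification (amalgam X \<S> Y) Z \<and> T_space i Z"
proof -
  \<comment> \<open>The three alternatives become one implication about one embedding: a proper
    connectification makes \<open>f\<close> non-surjective, and otherwise any connectification will
    do.\<close>
  obtain W :: "'c topology" and f where W: "connected_space W" "T_space i W" "dense_embedding X W f"
    and top: "topspace X \<in> \<S> \<Longrightarrow> f ` topspace X \<noteq> topspace W \<or> connected_space (Y (topspace X))"
    using assms(6,8) unfolding connectification_def proper_connectification_def by metis
  have t1: "t1_space W"
    using W(2) by (rule T_space_imp_t1)
  have emb: "embedding_map X W f" and opens: "\<And>S. S \<in> \<S> \<Longrightarrow> openin X S"
    using W(3) assms(3) by (auto simp: dense_embedding_def subbase_of_def)
  obtain e where e: "\<And>S. S \<in> \<S> \<Longrightarrow> openin W (e S) \<and> {x \<in> topspace X. f x \<in> e S} = S"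
    and e_top: "\<And>S. \<lbrakk>S \<in> \<S>; e S = topspace W\<rbrakk> \<Longrightarrow> connected_space (Y S)"
    by (rule extend_subbase[where P = "\<lambda>S. connected_space (Y S)", OF emb t1 opens top]) auto
  \<comment> \<open>The trace on \<open>X\<close> recovers \<open>S\<close> from \<open>e S\<close>,
    so the factor over an extended set is well defined.\<close>
  define Y' where "Y' T = (if T \<in> e ` \<S> then Y {x \<in> topspace X. f x \<in> T}
      else discrete_topology {undefined})" for T
  have Y'_e: "Y' (e S) = Y S" if "S \<in> \<S>" for S
    using e[OF that] that by (simp add: Y'_def)
  \<comment> \<open>Every factor over \<open>W\<close> is an original one or a singleton, so
    nonemptiness, connectedness and the separation axiom are checked on these two kinds.\<close>
  have Y'_cases: "Q (Y' T)" if "\<And>S. S \<in> \<S> \<Longrightarrow> T = e S \<Longrightarrow> Q (Y S)" "Q (discrete_topology {undefined})" for Q T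
    using that Y'_e by (cases "T \<in> e ` \<S>") (auto simp: Y'_def)
  interpret A: amalgam_system X \<S> Y
    using assms(3,2,5) by (rule amalgam_system.intro)
  interpret B: amalgam_system W "{T. openin W T}" Y'
  proof (rule amalgam_system.intro[OF subbase_of_all_open t1_imp_t0_space[OF t1]])
    show "topspace (Y' T) \<noteq> {}" for T
      using assms(5) by (intro Y'_cases[where Q = "\<lambda>V. topspace V \<noteq> {}"]) simp_all
  qed
  \<comment> \<open>If \<open>topspace W\<close> is some \<open>e S\<close>, the choice of
    \<open>e\<close> made \<open>Y S\<close> connected; otherwise the factor is a singleton.\<close>
  have "connected_space (Y' (topspace W))"
    using e_top by (intro Y'_cases[where Q = connected_space])
      (auto simp: connected_space_discrete_topology)
  then have "connected_space B.Z"
    by (rule B.connected_space_amalgam[OF W(1)])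
  moreover have "T_space i (Y' T)" for T
    using assms(7) by (intro Y'_cases[where Q = "T_space i"] T_space_singleton)
  then have "T_space i B.Z"
    by (rule B.T_space_amalgam[OF W(2)])
  moreover have "\<exists>F. dense_embedding A.Z B.Z F"
  proof (rule dense_embedding_amalgam[OF A.amalgam_system_axioms B.amalgam_system_axioms W(3)])
    show "e S \<in> {T. openin W T} \<and> {x \<in> topspace X. f x \<in> e S} = S \<and> Y' (e S) = Y S"
      if "S \<in> \<S>" for S
      using e[OF that] Y'_e[OF that] by simp
    show "topspace (Y' T) = {undefined}" if "T \<in> {T. openin W T} - e ` \<S>" for T
      using that by (simp add: Y'_def)
  qed
  ultimately show ?thesis
    unfolding connectification_def by blast
qed

end
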